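(* Let $n\ge 1$ be an integer, let $m>0$ and $k>0$ be real parameters, and let $U\colon\mathbb{R}^n\to\mathbb{R}$ be a smooth function for which there is a constant $U_{\sup}\in\mathbb{R}$ with $$0\le U(q)\le U_{\sup}<+\infty\qquad\text{for all } q\in\mathbb{R}^n.$$ Consider the differential equation $$m\ddot q(t)=-k\,\lvert\dot q(t)\rvert\,\dot q(t)-\nabla U\bigl(q(t)\bigr),\qquad q(t)\in\mathbb{R}^n.$$ Then every solution $q$ of this equation whose initial kinetic energy at the initial time $t_0\in\mathbb{R}$ satisfies $$\frac{m}{2}\lvert\dot q(t_0)\rvert^2>U_{\sup}$$ explodes in the past in finite time.
   Context: Here $\lvert\cdot\rvert$ is the Euclidean norm on $\mathbb{R}^n$, dots denote derivatives with respect to the time $t$, and $\nabla U$ is the gradient of $U$. "Explodes in the past in finite time" means that the solution does not exist globally in the past: the maximal interval of existence of the solution $q$ with the given initial data at time $t_0$ has a finite left endpoint (it is bounded below). *)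

theory Defs
  imports "HOL-Analysis.Analysis"
begin

primrec C_k :: "nat \<Rightarrow> ('a::euclidean_space \<Rightarrow> real) \<Rightarrow> bool" where
  "C_k 0 f \<longleftrightarrow> continuous_on UNIV f"
| "C_k (Suc k) f \<longleftrightarrow> (\<forall>x. f differentiable (at x)) \<and>
     (\<forall>i\<in>Basis. C_k k (\<lambda>x. frechet_derivative f (at x) i))"

definition smooth :: "('a::euclidean_space \<Rightarrow> real) \<Rightarrow> bool" where
  "smooth f \<longleftrightarrow> (\<forall>k. C_k k f)"

definition gradient :: "('a::real_inner \<Rightarrow> real) \<Rightarrow> 'a \<Rightarrow> 'a" where
  "gradient f x = (THE D. GDERIV f x :> D)"

definition velocity :: "(real \<Rightarrow> 'a::real_normed_vector) \<Rightarrow> real \<Rightarrow> 'a" where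
  "velocity q t = vector_derivative q (at t)"

definition acceleration :: "(real \<Rightarrow> 'a::real_normed_vector) \<Rightarrow> real \<Rightarrow> 'a" where
  "acceleration q t = vector_derivative (velocity q) (at t)"

text \<open>A solution lives on an open interval; the values of \<open>q\<close> outside of it are irrelevant.
  Differentiability is required explicitly because \<^const>\<open>vector_derivative\<close> is total.\<close>

definition solution_on ::
  "real \<Rightarrow> real \<Rightarrow> ('a::real_inner \<Rightarrow> real) \<Rightarrow> real set \<Rightarrow> (real \<Rightarrow> 'a) \<Rightarrow> bool" where
  "solution_on m k U I q \<longleftrightarrow> open I \<and> is_interval I \<and>
     (\<forall>t\<in>I. q differentiable (at t) \<and> velocity q differentiable (at t) \<and>
        m *\<^sub>R acceleration q t
          = - (k * norm (velocity q t)) *\<^sub>R velocity q t - gradient U (q t))"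

text \<open>The union of all open intervals around \<open>t0\<close> that carry a solution with initial position
  \<open>q0\<close> and initial velocity \<open>v0\<close> at time \<open>t0\<close>. By uniqueness of solutions of the initial value
  problem these solutions agree on overlaps, so that the union is the domain of the maximal
  solution.\<close>

definition maximal_interval ::
  "real \<Rightarrow> real \<Rightarrow> ('a::real_inner \<Rightarrow> real) \<Rightarrow> real \<Rightarrow> 'a \<Rightarrow> 'a \<Rightarrow> real set" where
  "maximal_interval m k U t0 q0 v0 =
     \<Union>{J. t0 \<in> J \<and> (\<exists>p. solution_on m k U J p \<and> p t0 = q0 \<and> velocity p t0 = v0)}"

definition explodes_in_past ::
  "real \<Rightarrow> real \<Rightarrow> ('a::real_inner \<Rightarrow> real) \<Rightarrow> real \<Rightarrow> (real \<Rightarrow> 'a) \<Rightarrow> bool" where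
  "explodes_in_past m k U t0 q \<longleftrightarrow>
     bdd_below (maximal_interval m k U t0 (q t0) (velocity q t0))"

end

theory Submission
  imports Defs
begin

text \<open>Let \<open>W = |v|\<^sup>2 + 2 (U(q) - U_sup) / m\<close>, so that \<open>W \<le> |v|\<^sup>2\<close>. Along a solution
  \<open>W' = - (2 k / m) |v|\<^sup>3\<close>; hence \<open>W\<close> stays positive in the past, and there
  \<open>W' \<le> - (2 k / m) W sqrt W\<close>, i.e. \<open>(1 / sqrt W)' \<ge> k / m\<close>. As \<open>1 / sqrt W > 0\<close>, a solution
  can live before \<open>t0\<close> for a time of at most \<open>m / (k sqrt (W t0))\<close>, which depends only
  on the initial data and hence bounds all solutions in \<^const>\<open>maximal_interval\<close> at once.\<close>

text \<open>Turns the definite description behind \<open>gradient\<close> into a usable derivative: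
  the Riesz vector of the derivative gives existence, and uniqueness of derivatives gives
  uniqueness.\<close>

lemma GDERIV_gradient:
  fixes f :: "'a::euclidean_space \<Rightarrow> real"
  assumes "f differentiable (at x)"
  shows "GDERIV f x :> gradient f x"
proof -
  obtain f' where f': "(f has_derivative f') (at x)"
    using assms by (auto simp: differentiable_def)
  then have lin: "linear f'"
    by (rule has_derivative_linear)
  have "f' = (\<lambda>h. h \<bullet> (\<Sum>b\<in>Basis. f' b *\<^sub>R b))"
  proof
    fix h
    have "f' h = f' (\<Sum>b\<in>Basis. (h \<bullet> b) *\<^sub>R b)"
      by (simp add: euclidean_representation)
    also have "\<dots> = (\<Sum>b\<in>Basis. (h \<bullet> b) * f' b)"
      by (simp add: linear_sum[OF lin] linear_cmul[OF lin])
    also have "\<dots> = h \<bullet> (\<Sum>b\<in>Basis. f' b *\<^sub>R b)"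
      by (simp add: inner_sum_right mult.commute)
    finally show "f' h = h \<bullet> (\<Sum>b\<in>Basis. f' b *\<^sub>R b)" .
  qed
  with f' have D: "GDERIV f x :> (\<Sum>b\<in>Basis. f' b *\<^sub>R b)"
    by (simp add: gderiv_def)
  have unique: "E = E'" if "GDERIV f x :> E" "GDERIV f x :> E'" for E E'
  proof -
    have "(\<lambda>h. h \<bullet> E) = (\<lambda>h. h \<bullet> E')"
      using that unfolding gderiv_def by (rule has_derivative_unique)
    then show ?thesis
      by (metis vector_eq_ldot)
  qed
  show ?thesis
    unfolding gradient_def using D by (rule theI) (rule unique[OF _ D])
qed

lemma smooth_imp_differentiable: "smooth f \<Longrightarrow> f differentiable (at x)"
  unfolding smooth_def by (metis C_k.simps(2))

text \<open>Comparison with w' = -2 c w^(3/2): there 1 / sqrt w has slope c, so going back from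
  \<open>b\<close> it reaches 0 after time 1 / (c sqrt (w b)), where w blows up.\<close>

lemma riccati_past_lifespan_bound:
  fixes W W' :: "real \<Rightarrow> real"
  assumes "a \<le> b" and "c > 0" and "W b > 0"
    and deriv: "\<And>t. t \<in> {a..b} \<Longrightarrow> (W has_real_derivative W' t) (at t)"
    and nonpos: "\<And>t. t \<in> {a..b} \<Longrightarrow> W' t \<le> 0"
    and le: "\<And>t. t \<in> {a..b} \<Longrightarrow> W t > 0 \<Longrightarrow> W' t \<le> - (2 * c) * (W t * sqrt (W t))"
  shows "b - a \<le> 1 / (c * sqrt (W b))"
proof -
  \<comment> \<open>Monotonicity alone carries positivity back from \<open>b\<close>; only then does
    \<open>le\<close> apply and is \<open>1 / sqrt (W t)\<close> differentiable.\<close>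
  have pos: "W t > 0" if "t \<in> {a..b}" for t
  proof -
    have "W b \<le> W t"
    proof (rule DERIV_nonpos_imp_nonincreasing[where f = W])
      fix s assume "t \<le> s" "s \<le> b"
      with that have "s \<in> {a..b}" by simp
      then show "\<exists>y. (W has_real_derivative y) (at s) \<and> y \<le> 0"
        using deriv nonpos by blast
    qed (use that in simp)
    with \<open>W b > 0\<close> show ?thesis by simp
  qed
  \<comment> \<open>Subtracting the guaranteed growth \<open>c * t\<close> turns the slope bound
    into monotonicity of \<open>G\<close>.\<close>
  define G where "G t = 1 / sqrt (W t) - c * t" for t
  have "G a \<le> G b"
  proof (rule DERIV_nonneg_imp_nondecreasing[OF \<open>a \<le> b\<close>])
    fix t assume "a \<le> t" "t \<le> b"
    then have t: "t \<in> {a..b}" by simp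
    have "(G has_real_derivative - W' t / (2 * (W t * sqrt (W t))) - c) (at t)"
      unfolding G_def using pos[OF t]
      by (auto intro!: derivative_eq_intros deriv[OF t] simp: field_simps)
    moreover have "- W' t / (2 * (W t * sqrt (W t))) - c \<ge> 0"
      using le[OF t pos[OF t]] pos[OF t] by (simp add: field_simps)
    ultimately show "\<exists>y. (G has_real_derivative y) (at t) \<and> 0 \<le> y" by blast
  qed
  moreover have "1 / sqrt (W a) > 0"
    using pos[of a] \<open>a \<le> b\<close> by simp
  ultimately have "c * (b - a) \<le> 1 / sqrt (W b)"
    unfolding G_def right_diff_distrib by linarith
  then have "b - a \<le> 1 / sqrt (W b) / c"
    using \<open>c > 0\<close> by (simp only: pos_le_divide_eq mult.commute[of c])
  then show ?thesis
    by (simp add: mult.commute)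
qed

text \<open>The function is 2 / m times the total energy, up to a constant. The gradient force only
  exchanges kinetic and potential energy, so what remains is the power of the friction.\<close>

lemma solution_on_kinetic_excess_derivative:
  fixes U :: "'a::euclidean_space \<Rightarrow> real"
  assumes "m > 0" and "U differentiable (at (p t))"
    and "solution_on m k U J p" and "t \<in> J"
  shows "((\<lambda>t. (norm (velocity p t))\<^sup>2 + 2 / m * (U (p t) - C)) has_real_derivative
    - (2 * (k / m)) * norm (velocity p t) ^ 3) (at t)"
proof -
  let ?v = "velocity p t"
  have p: "(p has_vector_derivative ?v) (at t)"
    and v: "(velocity p has_vector_derivative acceleration p t) (at t)"
    and eq: "m *\<^sub>R acceleration p t = - (k * norm ?v) *\<^sub>R ?v - gradient U (p t)"
    using assms(3,4)
    by (auto simp: solution_on_def velocity_def acceleration_def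
        vector_derivative_works[symmetric])
  have "((\<lambda>t. U (p t)) has_derivative (\<lambda>h. (h *\<^sub>R ?v) \<bullet> gradient U (p t))) (at t)"
    using has_derivative_compose[OF p[unfolded has_vector_derivative_def]
        GDERIV_gradient[OF assms(2), unfolded gderiv_def]] .
  then have U: "((\<lambda>t. U (p t)) has_real_derivative ?v \<bullet> gradient U (p t)) (at t)"
    by (simp add: has_field_derivative_def mult_commute_abs)
  have "((\<lambda>t. velocity p t \<bullet> velocity p t) has_derivative
      (\<lambda>h. ?v \<bullet> (h *\<^sub>R acceleration p t) + (h *\<^sub>R acceleration p t) \<bullet> ?v)) (at t)"
    by (intro has_derivative_inner v[unfolded has_vector_derivative_def])
  then have "((\<lambda>t. (norm (velocity p t))\<^sup>2) has_real_derivative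
      2 * (?v \<bullet> acceleration p t)) (at t)"
    by (simp add: has_field_derivative_def power2_norm_eq_inner inner_commute
        algebra_simps mult_commute_abs)
  note * = DERIV_add[OF this DERIV_cmult[OF DERIV_diff[OF U DERIV_const], where c = "2 / m"]]
  \<comment> \<open>Power balance: pair the equation of motion with the velocity.\<close>
  have "m * (?v \<bullet> acceleration p t) = ?v \<bullet> (m *\<^sub>R acceleration p t)"
    by simp
  also have "\<dots> = - k * norm ?v ^ 3 - ?v \<bullet> gradient U (p t)"
    by (simp add: eq inner_diff_right dot_square_norm power2_eq_square power3_eq_cube)
  finally have power: "m * (?v \<bullet> acceleration p t) + ?v \<bullet> gradient U (p t) = - k * norm ?v ^ 3"
    by simp
  \<comment> \<open>The left side copies the derivative in \<open>*\<close>; the \<open>0\<close>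
    comes from the constant \<open>C\<close>.\<close>
  have "2 * (?v \<bullet> acceleration p t) + 2 / m * (?v \<bullet> gradient U (p t) - 0)
      = 2 / m * (m * (?v \<bullet> acceleration p t) + ?v \<bullet> gradient U (p t))"
    using \<open>m > 0\<close> by (simp add: distrib_left)
  also have "\<dots> = - (2 * (k / m)) * norm ?v ^ 3"
    by (simp add: power)
  finally have "2 * (?v \<bullet> acceleration p t) + 2 / m * (?v \<bullet> gradient U (p t) - 0)
      = - (2 * (k / m)) * norm ?v ^ 3" .
  with * show ?thesis by simp
qed

theorem mainTheorem1:
  fixes U :: "real ^ 'n \<Rightarrow> real" and m k U_sup t0 :: real
    and I :: "real set" and q :: "real \<Rightarrow> real ^ 'n"
  assumes "m > 0" and "k > 0"
    and "smooth U"
    and "\<And>x. 0 \<le> U x \<and> U x \<le> U_sup"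
    and "solution_on m k U I q" and "t0 \<in> I"
    and "m / 2 * (norm (velocity q t0))\<^sup>2 > U_sup"
  shows "explodes_in_past m k U t0 q"
proof -
  define W where "W p t = (norm (velocity p t))\<^sup>2 + 2 / m * (U (p t) - U_sup)"
    for p :: "real \<Rightarrow> real ^ 'n" and t
  define B where "B = 1 / (k / m * sqrt (W q t0))"
  have "0 \<le> 2 / m * U (q t0)"
    using assms(1,4) by simp
  moreover have "2 / m * U_sup < (norm (velocity q t0))\<^sup>2"
    using assms(1,7) by (simp add: field_simps)
  ultimately have W0: "W q t0 > 0"
    unfolding W_def right_diff_distrib by linarith
  \<comment> \<open>\<open>maximal_interval\<close> is a union over all solutions with these initial
    data, so the bound is proved for an arbitrary such \<open>p\<close>, with the same
    \<open>B\<close> for all.\<close>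
  have bound: "t0 - B \<le> a"
    if J: "t0 \<in> J" "solution_on m k U J p" and
      init: "p t0 = q t0" "velocity p t0 = velocity q t0" and "a \<in> J" "a \<le> t0" for J p a
  proof -
    have W_eq: "W p t0 = W q t0"
      using init by (simp add: W_def)
    have "t0 - a \<le> 1 / (k / m * sqrt (W p t0))"
    proof (rule riccati_past_lifespan_bound[where
          W' = "\<lambda>t. - (2 * (k / m)) * norm (velocity p t) ^ 3"])
      fix t assume t: "t \<in> {a..t0}"
      have "t \<in> J"
        using J \<open>a \<in> J\<close> t unfolding solution_on_def
        by (metis atLeastAtMost_iff mem_is_interval_1_I)
      then show "(W p has_real_derivative - (2 * (k / m)) * norm (velocity p t) ^ 3) (at t)"
        unfolding W_def
        using solution_on_kinetic_excess_derivative assms(1,3) J(2) smooth_imp_differentiable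
        by blast
      show "- (2 * (k / m)) * norm (velocity p t) ^ 3 \<le> 0"
        using assms(1,2) by simp
      assume pos: "W p t > 0"
      \<comment> \<open>Here \<open>U \<le> U_sup\<close> enters: the potential term is nonpositive,
        so the friction term |v|^3 dominates W^(3/2).\<close>
      have "W p t \<le> (norm (velocity p t))\<^sup>2"
        using assms(1) assms(4)[of "p t"] by (simp add: W_def divide_nonpos_pos)
      moreover from this have "sqrt (W p t) \<le> norm (velocity p t)"
        by (simp add: real_le_lsqrt)
      ultimately have "W p t * sqrt (W p t) \<le> (norm (velocity p t))\<^sup>2 * norm (velocity p t)"
        using pos by (intro mult_mono) auto
      then have "2 * (k / m) * (W p t * sqrt (W p t)) \<le> 2 * (k / m) * norm (velocity p t) ^ 3"
        using assms(1,2) by (intro mult_left_mono) (auto simp: power2_eq_square power3_eq_cube)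
      then show "- (2 * (k / m)) * norm (velocity p t) ^ 3
          \<le> - (2 * (k / m)) * (W p t * sqrt (W p t))"
        by simp
    qed (use assms(1,2) W0 W_eq \<open>a \<le> t0\<close> in auto)
    then show ?thesis
      by (simp add: B_def W_eq)
  qed
  have "B > 0"
    using assms(1,2) W0 by (simp add: B_def)
  have "t0 - B \<le> a" if "a \<in> maximal_interval m k U t0 (q t0) (velocity q t0)" for a
  proof (cases "a \<le> t0")
    case True
    with that show ?thesis
      unfolding maximal_interval_def using bound by blast
  next
    \<comment> \<open>Times after \<open>t0\<close> lie above \<open>t0 - B\<close> simply because
      \<open>B\<close> is positive.\<close>
    case False
    with \<open>B > 0\<close> show ?thesis by simp
  qed
  then show ?thesis
    unfolding explodes_in_past_def by (intro bdd_belowI)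
qed

end
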